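(* Let $S$ be a poset, let $\mathcal{O}S$ be the frame of upsets of $S$, and let $N(\mathcal{O}S)$ be the frame of nuclei of $\mathcal{O}S$. (1) If $S$ has no infinite antichains, then $N(\mathcal{O}S)$ is spatial. (2) If $S$ is totally ordered, then $N(\mathcal{O}S)$ is spatial.
   Context: An upset of a poset $S$ is a subset $U$ such that $s\in U$ and $s\le t$ imply $t\in U$; $\mathcal{O}S$ is the set of upsets ordered by inclusion. A nucleus on a frame $L$ is a map $j:L\to L$ with $a\le j(a)$, $j(j(a))=j(a)$, and $j(a\wedge b)=j(a)\wedge j(b)$ for all $a,b\in L$; the set $N(L)$ of nuclei on $L$, ordered pointwise, is a frame. A frame is spatial if it is isomorphic to the frame of open sets of some topological space. *)

theory Defs
  imports "HOL-Algebra.Complete_Lattice" "HOL-Analysis.Abstract_Topology"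
begin

locale frame = complete_lattice L for L (structure) +
  assumes meet_sup_distrib:
    "\<lbrakk>a \<in> carrier L; B \<subseteq> carrier L\<rbrakk> \<Longrightarrow> a \<sqinter> (\<Squnion> B) = \<Squnion> ((\<lambda>b. a \<sqinter> b) ` B)"

definition upset :: "('a, 'c) gorder_scheme \<Rightarrow> 'a set \<Rightarrow> bool" where
  "upset S U \<longleftrightarrow> U \<subseteq> carrier S \<and> (\<forall>s\<in>U. \<forall>t\<in>carrier S. s \<sqsubseteq>\<^bsub>S\<^esub> t \<longrightarrow> t \<in> U)"

definition upset_frame :: "('a, 'c) gorder_scheme \<Rightarrow> 'a set gorder" where
  "upset_frame S = \<lparr>carrier = {U. upset S U}, eq = (=), le = (\<subseteq>)\<rparr>"

definition antichain :: "('a, 'c) gorder_scheme \<Rightarrow> 'a set \<Rightarrow> bool" where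
  "antichain S A \<longleftrightarrow> A \<subseteq> carrier S \<and> (\<forall>x\<in>A. \<forall>y\<in>A. x \<noteq> y \<longrightarrow> \<not> x \<sqsubseteq>\<^bsub>S\<^esub> y)"

text \<open>A nucleus is a function on the carrier only. It is therefore required to be extensional
  (membership in an extensional function space), so that two nuclei are equal as soon as they
  agree on the carrier.\<close>

definition nucleus :: "('a, 'c) gorder_scheme \<Rightarrow> ('a \<Rightarrow> 'a) \<Rightarrow> bool" where
  "nucleus L j \<longleftrightarrow>
     j \<in> carrier L \<rightarrow>\<^sub>E carrier L \<and>
     (\<forall>a\<in>carrier L. a \<sqsubseteq>\<^bsub>L\<^esub> j a) \<and>
     (\<forall>a\<in>carrier L. j (j a) = j a) \<and>
     (\<forall>a\<in>carrier L. \<forall>b\<in>carrier L. j (a \<sqinter>\<^bsub>L\<^esub> b) = j a \<sqinter>\<^bsub>L\<^esub> j b)"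

definition nuclei_frame :: "('a, 'c) gorder_scheme \<Rightarrow> ('a \<Rightarrow> 'a) gorder" where
  "nuclei_frame L =
     \<lparr>carrier = {j. nucleus L j}, eq = (=), le = (\<lambda>j k. \<forall>a\<in>carrier L. j a \<sqsubseteq>\<^bsub>L\<^esub> k a)\<rparr>"

definition open_frame :: "'a topology \<Rightarrow> 'a set gorder" where
  "open_frame X = \<lparr>carrier = {U. openin X U}, eq = (=), le = (\<subseteq>)\<rparr>"

text \<open>Between frames the order isomorphisms are exactly the frame isomorphisms.\<close>

definition order_iso :: "('a, 'c) gorder_scheme \<Rightarrow> ('b, 'd) gorder_scheme \<Rightarrow> ('a \<Rightarrow> 'b) \<Rightarrow> bool" where
  "order_iso L M f \<longleftrightarrow> order_emb L M f \<and> bij_betw f (carrier L) (carrier M)"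

text \<open>The type of the points of the space cannot be quantified existentially. Taking the points
  from the element type of the frame is no restriction: by \<open>spatialI\<close> below, a frame
  isomorphic to the open sets of a space over an arbitrary type is spatial in this sense.\<close>

definition spatial :: "('a, 'c) gorder_scheme \<Rightarrow> bool" where
  "spatial L \<longleftrightarrow> frame L \<and> (\<exists>(X :: 'a topology) f. order_iso L (open_frame X) f)"

lemma spatialI:
  fixes L :: "('a, 'c) gorder_scheme" and X :: "'b topology"
  assumes "frame L" and iso: "order_iso L (open_frame X) f"
  shows "spatial L"
proof -
  have bij: "bij_betw f (carrier L) {U. openin X U}"
    and emb: "\<And>a b. a \<in> carrier L \<Longrightarrow> b \<in> carrier L \<Longrightarrow> f a \<subseteq> f b \<longleftrightarrow> a \<sqsubseteq>\<^bsub>L\<^esub> b"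
    and wpo: "weak_partial_order L"
    using iso by (auto simp: order_iso_def order_emb_def open_frame_def)
  define W where "W x = \<Union>{U. openin X U \<and> x \<notin> U}" for x
  define p where "p x = inv_into (carrier L) f (W x)" for x
  have W: "openin X (W x)" for x
    unfolding W_def by (rule openin_Union) auto
  have fp: "f (p x) = W x" for x
    unfolding p_def using bij W[of x] by (metis bij_betw_inv_into_right mem_Collect_eq)
  have sat: "x \<in> U \<longleftrightarrow> y \<in> U" if "p x = p y" "openin X U" for x y U
  proof -
    have "W x = W y" using fp that(1) by metis
    moreover have "z \<in> U \<longleftrightarrow> \<not> U \<subseteq> W z" for z
      using that(2) by (auto simp: W_def)
    ultimately show ?thesis by metis
  qed
  have sub: "p ` U \<subseteq> p ` V \<longleftrightarrow> U \<subseteq> V" if "openin X U" "openin X V" for U V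
    using sat[OF _ that(2)] by blast
  define Y where "Y = topology (\<lambda>T. \<exists>U. openin X U \<and> T = p ` U)"
  have "istopology (\<lambda>T. \<exists>U. openin X U \<and> T = p ` U)"
    unfolding istopology_def
  proof (intro conjI allI impI)
    fix S T assume "\<exists>U. openin X U \<and> S = p ` U" "\<exists>U. openin X U \<and> T = p ` U"
    then obtain U V where UV: "openin X U" "S = p ` U" "openin X V" "T = p ` V" by blast
    have "S \<inter> T = p ` (U \<inter> V)"
      unfolding UV using sat[OF _ UV(1)] by blast
    then show "\<exists>U. openin X U \<and> S \<inter> T = p ` U"
      using UV by blast
  next
    fix K assume "\<forall>T\<in>K. \<exists>U. openin X U \<and> T = p ` U"
    then obtain u where u: "\<And>T. T \<in> K \<Longrightarrow> openin X (u T) \<and> T = p ` u T" by metis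
    have "\<Union> K = p ` \<Union> (u ` K)" using u by blast
    moreover have "openin X (\<Union> (u ` K))" using u by blast
    ultimately show "\<exists>U. openin X U \<and> \<Union> K = p ` U" by blast
  qed
  then have Y: "openin Y T \<longleftrightarrow> (\<exists>U. openin X U \<and> T = p ` U)" for T
    unfolding Y_def by simp
  have "bij_betw ((`) p) {U. openin X U} {T. openin Y T}"
    unfolding bij_betw_def inj_on_def by (auto simp: Y) (use sub in blast)+
  from bij_betw_trans[OF bij this]
  have "bij_betw (\<lambda>a. p ` f a) (carrier L) {T. openin Y T}"
    by (simp add: o_def)
  moreover have "p ` f a \<subseteq> p ` f b \<longleftrightarrow> a \<sqsubseteq>\<^bsub>L\<^esub> b" if "a \<in> carrier L" "b \<in> carrier L" for a b
    using sub[of "f a" "f b"] emb[OF that] bij that by (auto simp: bij_betw_def)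
  moreover have "weak_partial_order (open_frame Y)"
    by unfold_locales (auto simp: open_frame_def)
  ultimately have "order_iso L (open_frame Y) (\<lambda>a. p ` f a)"
    using wpo by (simp add: order_iso_def order_emb_def open_frame_def)
  with assms(1) show ?thesis
    unfolding spatial_def by blast
qed

end

theory Submission
  imports Defs
begin

text \<open>Identify an upset with its complement, a downset: the prime elements of \<open>\<O>S\<close> are the
  upsets with up-directed complement. If every \<open>j\<close>-fixed upset is an intersection of \<open>j\<close>-fixed
  primes, for each nucleus \<open>j\<close>, then \<open>j\<close> is determined by the set of primes it moves, and these
  sets are exactly the open sets of a topology on the primes. Without infinite antichains,
  there are enough fixed primes: if \<open>x \<notin> U\<close> and \<open>j U = U\<close>, some \<open>w \<ge> x\<close> outside \<open>U\<close> is such that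
  the part of \<open>\<up>w\<close> outside \<open>U\<close> is directed (otherwise, repeated branching yields an infinite
  antichain), and then the Heyting implication \<open>\<up>w \<rightarrow> U\<close> is a \<open>j\<close>-fixed prime above \<open>U\<close> that
  omits \<open>x\<close>. A chain has no infinite antichains.\<close>

section \<open>Frames isomorphic to a frame of open sets\<close>

lemma (in partial_order) inf_equality:
  "greatest L i (Lower L A) \<Longrightarrow> \<Sqinter>A = i"
  unfolding inf_def by (rule some_equality) (auto intro: greatest_unique)

lemma (in partial_order) sup_equality:
  "least L s (Upper L A) \<Longrightarrow> \<Squnion>A = s"
  unfolding sup_def by (rule some_equality) (auto intro: least_unique)

text \<open>\<open>spatial\<close> also demands the frame axioms. Transporting unions and
  intersections back along the isomorphism supplies them from a mere partial order, so that joins of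
  nuclei never have to be computed.\<close>

lemma frame_if_order_iso_open_frame:
  assumes "partial_order L" and iso: "order_iso L (open_frame X) f"
  shows "frame L"
proof -
  interpret partial_order L by fact
  have bij: "bij_betw f (carrier L) {U. openin X U}"
    and emb: "\<And>a b. a \<in> carrier L \<Longrightarrow> b \<in> carrier L \<Longrightarrow> f a \<subseteq> f b \<longleftrightarrow> a \<sqsubseteq>\<^bsub>L\<^esub> b"
    using iso by (auto simp: order_iso_def order_emb_def open_frame_def)
  define g where "g = inv_into (carrier L) f"
  have g: "g U \<in> carrier L" "f (g U) = U" if "openin X U" for U
    using bij that unfolding g_def
    by (auto simp: bij_betw_def inv_into_into f_inv_into_f)
  have f: "openin X (f a)" if "a \<in> carrier L" for a
    using bij that by (auto simp: bij_betw_def)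
  have inj: "a = b" if "a \<in> carrier L" "b \<in> carrier L" "f a = f b" for a b
    using bij that by (auto simp: bij_betw_def inj_on_def)
  have sup: "least L (g (\<Union>(f ` A))) (Upper L A)" if A: "A \<subseteq> carrier L" for A
  proof -
    have "openin X (\<Union>(f ` A))" using A f by blast
    note G = g[OF this]
    show ?thesis
    proof (rule least_UpperI)
      fix x assume "x \<in> A"
      then show "x \<sqsubseteq>\<^bsub>L\<^esub> g (\<Union>(f ` A))"
        using A G by (subst emb[symmetric]) auto
    next
      fix y assume y: "y \<in> Upper L A"
      then have yc: "y \<in> carrier L" using Upper_closed[of L A] by blast
      have "f a \<subseteq> f y" if "a \<in> A" for a
        using A that y yc emb by (blast dest: Upper_memD)
      then show "g (\<Union>(f ` A)) \<sqsubseteq>\<^bsub>L\<^esub> y"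
        using G yc by (subst emb[symmetric]) auto
    qed (use A G in auto)
  qed
  have inf: "\<exists>i. greatest L i (Lower L A)" if A: "A \<subseteq> carrier L" for A
  proof -
    \<comment> \<open>The infimum of a family of open sets is the interior of its intersection; for
      empty \<open>A\<close> this is the whole space.\<close>
    define W where "W = \<Union>{U. openin X U \<and> (\<forall>a\<in>A. U \<subseteq> f a)}"
    have "openin X W" unfolding W_def by (rule openin_Union) auto
    note G = g[OF this]
    have "greatest L (g W) (Lower L A)"
    proof (rule greatest_LowerI)
      fix x assume "x \<in> A"
      then show "g W \<sqsubseteq>\<^bsub>L\<^esub> x"
        using A G by (subst emb[symmetric]) (auto simp: W_def)
    next
      fix y assume y: "y \<in> Lower L A"
      then have yc: "y \<in> carrier L" using Lower_closed[of L A] by blast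
      have "\<forall>a\<in>A. f y \<subseteq> f a"
        using A y yc emb by (blast dest: Lower_memD)
      then have "f y \<subseteq> W" using f[OF yc] by (auto simp: W_def)
      then show "y \<sqsubseteq>\<^bsub>L\<^esub> g W"
        using G yc by (subst emb[symmetric]) auto
    qed (use A G in auto)
    then show ?thesis ..
  qed
  have fsup: "f (\<Squnion>\<^bsub>L\<^esub>A) = \<Union>(f ` A)" "\<Squnion>\<^bsub>L\<^esub>A \<in> carrier L" if A: "A \<subseteq> carrier L" for A
  proof -
    have "openin X (\<Union>(f ` A))" using A f by blast
    then show "f (\<Squnion>\<^bsub>L\<^esub>A) = \<Union>(f ` A)" "\<Squnion>\<^bsub>L\<^esub>A \<in> carrier L"
      using g sup_equality[OF sup[OF A]] by auto
  qed
  have fmeet: "f (a \<sqinter>\<^bsub>L\<^esub> b) = f a \<inter> f b" "a \<sqinter>\<^bsub>L\<^esub> b \<in> carrier L"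
    if ab: "a \<in> carrier L" "b \<in> carrier L" for a b
  proof -
    have "openin X (f a \<inter> f b)" using ab f by blast
    note G = g[OF this]
    have "greatest L (g (f a \<inter> f b)) (Lower L {a, b})"
    proof (rule greatest_LowerI)
      fix x assume "x \<in> {a, b}"
      then show "g (f a \<inter> f b) \<sqsubseteq>\<^bsub>L\<^esub> x"
        using ab G by (subst emb[symmetric]) auto
    next
      fix y assume y: "y \<in> Lower L {a, b}"
      then have yc: "y \<in> carrier L" using Lower_closed[of L "{a, b}"] by blast
      have "f y \<subseteq> f a \<inter> f b"
        using ab y yc emb by (blast dest: Lower_memD)
      then show "y \<sqsubseteq>\<^bsub>L\<^esub> g (f a \<inter> f b)"
        using G yc by (subst emb[symmetric]) auto
    qed (use ab G in auto)
    then have "a \<sqinter>\<^bsub>L\<^esub> b = g (f a \<inter> f b)"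
      unfolding meet_def by (rule inf_equality)
    with G show "f (a \<sqinter>\<^bsub>L\<^esub> b) = f a \<inter> f b" "a \<sqinter>\<^bsub>L\<^esub> b \<in> carrier L" by simp_all
  qed
  show ?thesis
  proof unfold_locales
    fix A assume "A \<subseteq> carrier L"
    then show "\<exists>s. least L s (Upper L A)" using sup by blast
  next
    fix A assume "A \<subseteq> carrier L"
    then show "\<exists>i. greatest L i (Lower L A)" by (rule inf)
  next
    fix a B assume a: "a \<in> carrier L" and B: "B \<subseteq> carrier L"
    then have C: "(\<lambda>b. a \<sqinter>\<^bsub>L\<^esub> b) ` B \<subseteq> carrier L" using fmeet by blast
    have "f b \<inter> f a = f (a \<sqinter>\<^bsub>L\<^esub> b)" if "b \<in> B" for b
      using a B that fmeet by blast
    then have "f (a \<sqinter>\<^bsub>L\<^esub> \<Squnion>\<^bsub>L\<^esub>B) = f (\<Squnion>\<^bsub>L\<^esub>((\<lambda>b. a \<sqinter>\<^bsub>L\<^esub> b) ` B))"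
      using a B C by (auto simp: fmeet fsup)
    with a B C show "a \<sqinter>\<^bsub>L\<^esub> (\<Squnion>\<^bsub>L\<^esub>B) = \<Squnion>\<^bsub>L\<^esub>((\<lambda>b. a \<sqinter>\<^bsub>L\<^esub> b) ` B)"
      by (intro inj fmeet fsup)
  qed
qed

section \<open>Nuclei on a frame of upsets\<close>

lemma upset_Int: "upset S U \<Longrightarrow> upset S V \<Longrightarrow> upset S (U \<inter> V)"
  by (auto simp: upset_def)

lemma upset_carrier_Int_Inter: "(\<And>U. U \<in> K \<Longrightarrow> upset S U) \<Longrightarrow> upset S (carrier S \<inter> \<Inter>K)"
  unfolding upset_def by blast

lemma carrier_upset_frame [simp]: "carrier (upset_frame S) = {U. upset S U}"
  and le_upset_frame [simp]: "le (upset_frame S) = (\<subseteq>)"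
  by (simp_all add: upset_frame_def)

lemma partial_order_upset_frame: "partial_order (upset_frame S)"
  by unfold_locales (auto simp: upset_frame_def)

lemma meet_upset_frame:
  assumes "upset S U" "upset S V"
  shows "U \<sqinter>\<^bsub>upset_frame S\<^esub> V = U \<inter> V"
proof -
  interpret partial_order "upset_frame S" by (rule partial_order_upset_frame)
  have "greatest (upset_frame S) (U \<inter> V) (Lower (upset_frame S) {U, V})"
    using assms by (auto simp: greatest_def Lower_def intro: upset_Int)
  then show ?thesis unfolding meet_def by (rule inf_equality)
qed

lemma nucleus_upset_frame_iff:
  "nucleus (upset_frame S) j \<longleftrightarrow>
     j \<in> extensional {U. upset S U} \<and>
     (\<forall>U. upset S U \<longrightarrow> upset S (j U) \<and> U \<subseteq> j U \<and> j (j U) = j U) \<and>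
     (\<forall>U V. upset S U \<longrightarrow> upset S V \<longrightarrow> j (U \<inter> V) = j U \<inter> j V)"
  unfolding nucleus_def by (auto simp: PiE_def Pi_def meet_upset_frame)

lemma partial_order_nuclei_frame: "partial_order (nuclei_frame (upset_frame S))"
proof unfold_locales
  fix j k
  assume "j \<sqsubseteq>\<^bsub>nuclei_frame (upset_frame S)\<^esub> k" "k \<sqsubseteq>\<^bsub>nuclei_frame (upset_frame S)\<^esub> j"
    "j \<in> carrier (nuclei_frame (upset_frame S))" "k \<in> carrier (nuclei_frame (upset_frame S))"
  \<comment> \<open>Mutual domination yields agreement on upsets only; extensionality turns it into
    equality.\<close>
  then have "j = k"
    by (auto simp: nuclei_frame_def nucleus_upset_frame_iff intro!: extensionalityI)
  then show "j .=\<^bsub>nuclei_frame (upset_frame S)\<^esub> k" by (simp add: nuclei_frame_def)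
qed (auto simp: nuclei_frame_def)

context
  fixes S :: "('a, 'c) gorder_scheme" and j
  assumes nucleus: "nucleus (upset_frame S) j"
begin

lemma nucleus_upset: "upset S U \<Longrightarrow> upset S (j U)"
  and nucleus_inflationary: "upset S U \<Longrightarrow> U \<subseteq> j U"
  and nucleus_idem: "upset S U \<Longrightarrow> j (j U) = j U"
  and nucleus_Int: "upset S U \<Longrightarrow> upset S V \<Longrightarrow> j (U \<inter> V) = j U \<inter> j V"
  using nucleus by (auto simp: nucleus_upset_frame_iff)

lemma nucleus_mono: "upset S U \<Longrightarrow> upset S V \<Longrightarrow> U \<subseteq> V \<Longrightarrow> j U \<subseteq> j V"
  using nucleus_Int[of U V] by (metis Int_absorb2 Int_lower2)

end

section \<open>Prime upsets and the topology on them\<close>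

definition prime_upset :: "('a, 'c) gorder_scheme \<Rightarrow> 'a set \<Rightarrow> bool" where
  "prime_upset S P \<longleftrightarrow> upset S P \<and> P \<noteq> carrier S \<and>
     (\<forall>U V. upset S U \<longrightarrow> upset S V \<longrightarrow> U \<inter> V \<subseteq> P \<longrightarrow> U \<subseteq> P \<or> V \<subseteq> P)"

text \<open>Intersecting with \<open>carrier S\<close> keeps the hull inside the poset when no
  member of \<open>Q\<close> contains \<open>U\<close>.\<close>

definition prime_hull :: "('a, 'c) gorder_scheme \<Rightarrow> 'a set set \<Rightarrow> 'a set \<Rightarrow> 'a set" where
  "prime_hull S Q U = carrier S \<inter> \<Inter>{P \<in> Q. U \<subseteq> P}"

lemma upset_prime_hull: "Q \<subseteq> {P. prime_upset S P} \<Longrightarrow> upset S (prime_hull S Q U)"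
  unfolding prime_hull_def by (rule upset_carrier_Int_Inter) (auto simp: prime_upset_def)

lemma subset_prime_hull: "upset S U \<Longrightarrow> U \<subseteq> prime_hull S Q U"
  by (auto simp: prime_hull_def upset_def)

text \<open>Primality gives preservation of binary meets: a prime contains
  \<open>U \<inter> V\<close> iff it contains \<open>U\<close> or \<open>V\<close>, so the primes of
  \<open>Q\<close> above \<open>U \<inter> V\<close> are those above \<open>U\<close> together with
  those above \<open>V\<close>.\<close>

lemma nucleus_prime_hull:
  assumes Q: "Q \<subseteq> {P. prime_upset S P}"
  shows "nucleus (upset_frame S) (restrict (prime_hull S Q) {U. upset S U})"
proof -
  have "prime_hull S Q (prime_hull S Q U) = prime_hull S Q U" for U
    by (auto simp: prime_hull_def)
  moreover have "prime_hull S Q (U \<inter> V) = prime_hull S Q U \<inter> prime_hull S Q V"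
    if UV: "upset S U" "upset S V" for U V
  proof -
    have "U \<inter> V \<subseteq> P \<longleftrightarrow> U \<subseteq> P \<or> V \<subseteq> P" if "P \<in> Q" for P
      using Q UV that unfolding prime_upset_def by blast
    then have "{P \<in> Q. U \<inter> V \<subseteq> P} = {P \<in> Q. U \<subseteq> P} \<union> {P \<in> Q. V \<subseteq> P}" by blast
    then show ?thesis by (auto simp: prime_hull_def)
  qed
  ultimately show ?thesis
    using upset_prime_hull[OF Q]
    by (simp add: nucleus_upset_frame_iff upset_Int subset_prime_hull)
qed

text \<open>An intrinsic description of the sets of primes moved by some nucleus: the hull nucleus
  of the complement of \<open>T\<close> fixes every prime outside \<open>T\<close>, and the
  condition says that it moves every prime in \<open>T\<close>.\<close>

definition prime_open :: "('a, 'c) gorder_scheme \<Rightarrow> 'a set set \<Rightarrow> bool" where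
  "prime_open S T \<longleftrightarrow> T \<subseteq> {P. prime_upset S P} \<and>
     (\<forall>P\<in>T. \<not> prime_hull S ({P. prime_upset S P} - T) P \<subseteq> P)"

lemma istopology_prime_open: "istopology (prime_open S)"
  unfolding istopology_def
proof (intro conjI allI impI)
  let ?h = "\<lambda>T. prime_hull S ({P. prime_upset S P} - T)"
  fix T T' assume T: "prime_open S T" "prime_open S T'"
  have "\<not> ?h (T \<inter> T') P \<subseteq> P" if "P \<in> T" "P \<in> T'" for P
  proof -
    have P: "prime_upset S P" using T that by (auto simp: prime_open_def)
    have "\<not> ?h T P \<subseteq> P" "\<not> ?h T' P \<subseteq> P"
      using T that by (simp_all add: prime_open_def)
    \<comment> \<open>Neither hull lies in the prime \<open>P\<close>, hence neither does their
      intersection.\<close>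
    then have "\<not> ?h T P \<inter> ?h T' P \<subseteq> P"
      using P upset_prime_hull[OF Diff_subset] unfolding prime_upset_def by blast
    moreover have "?h T P \<inter> ?h T' P \<subseteq> ?h (T \<inter> T') P"
      by (auto simp: prime_hull_def)
    ultimately show ?thesis by blast
  qed
  with T show "prime_open S (T \<inter> T')" by (auto simp: prime_open_def)
next
  fix K assume K: "\<forall>T\<in>K. prime_open S T"
  have "\<not> prime_hull S ({P. prime_upset S P} - \<Union>K) P \<subseteq> P" if "P \<in> T" "T \<in> K" for P T
  proof -
    have "\<not> prime_hull S ({P. prime_upset S P} - T) P \<subseteq> P"
      using K that by (simp add: prime_open_def)
    \<comment> \<open>Fewer primes to intersect give a larger hull.\<close>
    moreover have "prime_hull S ({P. prime_upset S P} - T) P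
        \<subseteq> prime_hull S ({P. prime_upset S P} - \<Union>K) P"
      using that by (auto simp: prime_hull_def)
    ultimately show ?thesis by blast
  qed
  with K show "prime_open S (\<Union>K)" by (auto simp: prime_open_def)
qed

text \<open>The isomorphism sends \<open>j\<close> to the set of primes that it moves. Enough fixed
  primes make this an order embedding; hull nuclei make it surjective.\<close>

lemma spatial_nuclei_if_enough_fixed_primes:
  assumes enough: "\<And>j U x. nucleus (upset_frame S) j \<Longrightarrow> upset S U \<Longrightarrow> j U = U \<Longrightarrow>
      x \<in> carrier S \<Longrightarrow> x \<notin> U \<Longrightarrow> \<exists>P. prime_upset S P \<and> j P = P \<and> U \<subseteq> P \<and> x \<notin> P"
  shows "spatial (nuclei_frame (upset_frame S))"
proof -
  define X where "X = topology (prime_open S)"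
  have X: "openin X = prime_open S"
    unfolding X_def by (rule topology_inverse') (rule istopology_prime_open)
  define f where "f j = {P. prime_upset S P \<and> j P \<noteq> P}" for j
  have primeD: "upset S P" if "prime_upset S P" for P
    using that by (simp add: prime_upset_def)
  have "prime_open S (f j)" if j: "nucleus (upset_frame S) j" for j
    unfolding prime_open_def
  proof (intro conjI ballI notI)
    fix P assume P: "P \<in> f j" and hull: "prime_hull S ({P. prime_upset S P} - f j) P \<subseteq> P"
    then have PS: "upset S P" by (auto simp: f_def primeD)
    \<comment> \<open>Every \<open>j\<close>-fixed prime above \<open>P\<close> contains
      \<open>j P\<close>, so \<open>j P\<close> lies in the hull of \<open>P\<close>; a hull inside
      \<open>P\<close> would force \<open>j\<close> to fix \<open>P\<close>.\<close>
    have "j P \<subseteq> Q" if "prime_upset S Q" "j Q = Q" "P \<subseteq> Q" for Q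
      using nucleus_mono[OF j PS primeD[OF that(1)] that(3)] that(2) by simp
    moreover have "j P \<subseteq> carrier S"
      using nucleus_upset[OF j PS] by (simp add: upset_def)
    ultimately have "j P \<subseteq> prime_hull S ({P. prime_upset S P} - f j) P"
      by (auto simp: prime_hull_def f_def)
    then have "j P = P" using hull nucleus_inflationary[OF j PS] by blast
    with P show False by (simp add: f_def)
  qed (auto simp: f_def)
  moreover have emb: "f j \<subseteq> f k \<longleftrightarrow> (\<forall>U. upset S U \<longrightarrow> j U \<subseteq> k U)"
    if j: "nucleus (upset_frame S) j" and k: "nucleus (upset_frame S) k" for j k
  proof
    assume fjk: "f j \<subseteq> f k"
    show "\<forall>U. upset S U \<longrightarrow> j U \<subseteq> k U"
    proof (intro allI impI subsetI)
      fix U x assume U: "upset S U" and x: "x \<in> j U"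
      note kU = nucleus_upset[OF k U]
      show "x \<in> k U"
      \<comment> \<open>A \<open>k\<close>-fixed prime above \<open>k U\<close> that omits
        \<open>x\<close> is also \<open>j\<close>-fixed since \<open>f j \<subseteq> f k\<close>; it
        then contains \<open>j U\<close>, and so \<open>x\<close>.\<close>
      proof (rule ccontr)
        assume "x \<notin> k U"
        moreover have "x \<in> carrier S"
          using x nucleus_upset[OF j U] by (auto simp: upset_def)
        ultimately obtain P where P: "prime_upset S P" "k P = P" "k U \<subseteq> P" "x \<notin> P"
          using enough[OF k kU nucleus_idem[OF k U]] by blast
        have "j P = P" using fjk P by (auto simp: f_def)
        moreover have "U \<subseteq> P" using P nucleus_inflationary[OF k U] by blast
        ultimately have "j U \<subseteq> P"
          using nucleus_mono[OF j U primeD[OF P(1)]] by simp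
        with x P show False by blast
      qed
    qed
  next
    assume le: "\<forall>U. upset S U \<longrightarrow> j U \<subseteq> k U"
    have "j P = P" if "prime_upset S P" "k P = P" for P
      using le nucleus_inflationary[OF j primeD[OF that(1)]] primeD[OF that(1)] that(2) by blast
    then show "f j \<subseteq> f k" by (auto simp: f_def)
  qed
  moreover have "T \<in> f ` {j. nucleus (upset_frame S) j}" if T: "prime_open S T" for T
  proof
    \<comment> \<open>The preimage of an open set is the hull nucleus of its complement.\<close>
    let ?Q = "{P. prime_upset S P} - T"
    let ?j = "restrict (prime_hull S ?Q) {U. upset S U}"
    show "?j \<in> {j. nucleus (upset_frame S) j}"
      by (simp add: nucleus_prime_hull)
    have "?j P \<noteq> P \<longleftrightarrow> P \<in> T" if P: "prime_upset S P" for P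
    proof (cases "P \<in> T")
      case True
      then show ?thesis using T primeD[OF P] by (auto simp: prime_open_def)
    next
      case False
      with P have "prime_hull S ?Q P \<subseteq> P" by (auto simp: prime_hull_def)
      with False show ?thesis using subset_prime_hull[OF primeD[OF P]] primeD[OF P] by auto
    qed
    with T show "T = f ?j" unfolding f_def prime_open_def by blast
  qed
  moreover have "inj_on f {j. nucleus (upset_frame S) j}"
  proof (rule inj_onI)
    fix j k assume jk: "j \<in> {j. nucleus (upset_frame S) j}" "k \<in> {j. nucleus (upset_frame S) j}"
      and "f j = f k"
    then have "j U = k U" if "upset S U" for U
      using emb[of j k] emb[of k j] that by auto
    with jk show "j = k"
      by (auto simp: nucleus_upset_frame_iff intro!: extensionalityI)
  qed
  ultimately have "bij_betw f {j. nucleus (upset_frame S) j} {T. prime_open S T}"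
    unfolding bij_betw_def by blast
  moreover have "weak_partial_order (open_frame X)"
    by unfold_locales (auto simp: open_frame_def)
  moreover have "weak_partial_order (nuclei_frame (upset_frame S))"
    using partial_order_nuclei_frame by (rule partial_order.axioms)
  ultimately have "order_iso (nuclei_frame (upset_frame S)) (open_frame X) f"
    using emb by (simp add: order_iso_def order_emb_def X open_frame_def nuclei_frame_def)
  with partial_order_nuclei_frame show ?thesis
    by (intro spatialI frame_if_order_iso_open_frame)
qed

section \<open>Posets without infinite antichains\<close>

text \<open>Otherwise every \<open>w\<close> in \<open>T\<close> has two successors
  \<open>y w\<close> and \<open>z w\<close> without a common upper bound in \<open>T\<close>.
  Following \<open>z\<close> forever gives an ascending sequence, and the \<open>y\<close>-branches
  that leave it form an infinite antichain.\<close>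

lemma (in weak_partial_order) directed_above_if_no_infinite_antichain:
  assumes T: "T \<subseteq> carrier L" "T \<noteq> {}"
    and no_antichain: "\<nexists>A. antichain L A \<and> infinite A"
  shows "\<exists>w\<in>T. \<forall>y\<in>T. \<forall>z\<in>T. w \<sqsubseteq> y \<longrightarrow> w \<sqsubseteq> z \<longrightarrow> (\<exists>t\<in>T. y \<sqsubseteq> t \<and> z \<sqsubseteq> t)"
proof (rule ccontr)
  assume "\<not> ?thesis"
  then have "\<forall>w\<in>T. \<exists>y z. y \<in> T \<and> z \<in> T \<and> w \<sqsubseteq> y \<and> w \<sqsubseteq> z \<and> \<not> (\<exists>t\<in>T. y \<sqsubseteq> t \<and> z \<sqsubseteq> t)"
    by blast
  then obtain y z where yz: "\<And>w. w \<in> T \<Longrightarrow> y w \<in> T \<and> z w \<in> T \<and> w \<sqsubseteq> y w \<and> w \<sqsubseteq> z w"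
    and incompatible: "\<And>w t. w \<in> T \<Longrightarrow> t \<in> T \<Longrightarrow> y w \<sqsubseteq> t \<Longrightarrow> z w \<sqsubseteq> t \<Longrightarrow> False"
    by metis
  obtain w where w: "w \<in> T" using T by blast
  define s where "s n = (z ^^ n) w" for n
  have s: "s n \<in> T" for n by (induction n) (auto simp: s_def w yz)
  have s_mono: "s m \<sqsubseteq> s n" if "m \<le> n" for m n
    using that
  proof (induction n rule: dec_induct)
    case base
    then show ?case using s T by auto
  next
    case (step n)
    have "s n \<sqsubseteq> s (Suc n)" using yz[OF s[of n]] by (simp add: s_def)
    with step.IH show ?case using s T by (meson le_trans subsetD)
  qed
  \<comment> \<open>For \<open>m < n\<close>, the element \<open>y (s n)\<close> lies above
    \<open>s (Suc m) = z (s m)\<close>. A common upper bound of the two branches in \<open>T\<close>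
    would thus bound both \<open>y (s m)\<close> and \<open>z (s m)\<close>.\<close>
  have incomparable: "\<not> (y (s m) \<sqsubseteq> t \<and> y (s n) \<sqsubseteq> t)" if "m < n" "t \<in> T" for m n t
  proof
    assume t: "y (s m) \<sqsubseteq> t \<and> y (s n) \<sqsubseteq> t"
    have "z (s m) \<sqsubseteq> s n" using s_mono[of "Suc m" n] that by (simp add: s_def)
    moreover have "s n \<sqsubseteq> y (s n)" using yz s by blast
    ultimately have "z (s m) \<sqsubseteq> t"
      using t that(2) yz s T by (meson le_trans subsetD)
    with t show False using incompatible[OF s that(2)] by blast
  qed
  have refl: "y (s n) \<sqsubseteq> y (s n)" for n using yz s T by blast
  \<comment> \<open>If the two were comparable, the larger one would itself be a common upper bound
    in \<open>T\<close>.\<close>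
  have distinct: "\<not> y (s m) \<sqsubseteq> y (s n)" if "m \<noteq> n" for m n
    using that incomparable[of m n "y (s n)"] incomparable[of n m "y (s n)"] refl yz s
    by (meson linorder_neqE_nat)
  then have "inj (\<lambda>n. y (s n))" using refl by (metis injI)
  then have "infinite (range (\<lambda>n. y (s n)))" by (rule range_inj_infinite)
  moreover have "antichain L (range (\<lambda>n. y (s n)))"
    unfolding antichain_def
  proof (intro conjI ballI impI)
    show "range (\<lambda>n. y (s n)) \<subseteq> carrier L" using yz[OF s] T(1) by auto
  next
    fix a b assume "a \<in> range (\<lambda>n. y (s n))" "b \<in> range (\<lambda>n. y (s n))" "a \<noteq> b"
    then obtain m n where "a = y (s m)" "b = y (s n)" "m \<noteq> n" by auto
    then show "\<not> a \<sqsubseteq> b" using distinct by simp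
  qed
  ultimately show False using no_antichain by blast
qed

lemma enough_fixed_primes_if_no_infinite_antichain:
  assumes "weak_partial_order S" and no_antichain: "\<nexists>A. antichain S A \<and> infinite A"
    and j: "nucleus (upset_frame S) j" and U: "upset S U" "j U = U"
    and x: "x \<in> carrier S" "x \<notin> U"
  shows "\<exists>P. prime_upset S P \<and> j P = P \<and> U \<subseteq> P \<and> x \<notin> P"
proof -
  interpret weak_partial_order S by fact
  let ?T = "{s \<in> carrier S. x \<sqsubseteq>\<^bsub>S\<^esub> s \<and> s \<notin> U}"
  have T: "?T \<subseteq> carrier S" "?T \<noteq> {}" using x by auto
  obtain w where "w \<in> ?T"
    and directed: "\<forall>y\<in>?T. \<forall>z\<in>?T. w \<sqsubseteq>\<^bsub>S\<^esub> y \<longrightarrow> w \<sqsubseteq>\<^bsub>S\<^esub> z \<longrightarrow>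
      (\<exists>t\<in>?T. y \<sqsubseteq>\<^bsub>S\<^esub> t \<and> z \<sqsubseteq>\<^bsub>S\<^esub> t)"
    using directed_above_if_no_infinite_antichain[OF T no_antichain] by (elim bexE)
  then have w: "w \<in> carrier S" "x \<sqsubseteq>\<^bsub>S\<^esub> w" "w \<notin> U" by simp_all
  \<comment> \<open>\<open>W\<close> is the principal upset of \<open>w\<close>, and
    \<open>P\<close> is the Heyting implication from \<open>W\<close> to \<open>U\<close>, the
    largest upset whose intersection with \<open>W\<close> lies in \<open>U\<close>.\<close>
  define W where "W = {t \<in> carrier S. w \<sqsubseteq>\<^bsub>S\<^esub> t}"
  define P where "P = {s \<in> carrier S. \<forall>t\<in>W. s \<sqsubseteq>\<^bsub>S\<^esub> t \<longrightarrow> t \<in> U}"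
  have W: "upset S W" using w(1) by (auto simp: upset_def W_def intro: le_trans)
  have P: "upset S P"
    unfolding upset_def P_def W_def using le_trans by blast
  have UP: "U \<subseteq> P" using U(1) unfolding upset_def P_def W_def by blast
  have xP: "x \<notin> P" using w by (auto simp: P_def W_def)
  \<comment> \<open>\<open>j P \<inter> W\<close> lies in
    \<open>j P \<inter> j W = j (P \<inter> W)\<close>, hence in \<open>j U = U\<close>; maximality
    of \<open>P\<close> then gives \<open>j P \<subseteq> P\<close>.\<close>
  have "P \<inter> W \<subseteq> U" by (auto simp: P_def W_def)
  then have "j P \<inter> j W \<subseteq> U"
    using nucleus_mono[OF j upset_Int[OF P W] U(1)] U(2) nucleus_Int[OF j P W] by simp
  then have "j P \<inter> W \<subseteq> U" using nucleus_inflationary[OF j W] by blast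
  then have "j P \<subseteq> P"
    using nucleus_upset[OF j P] by (auto simp: P_def W_def upset_def)
  then have "j P = P" using nucleus_inflationary[OF j P] by blast
  moreover have "A \<subseteq> P \<or> B \<subseteq> P" if A: "upset S A" and B: "upset S B" and AB: "A \<inter> B \<subseteq> P" for A B
  proof (rule ccontr)
    assume "\<not> (A \<subseteq> P \<or> B \<subseteq> P)"
    \<comment> \<open>A point of \<open>A\<close> outside \<open>P\<close> lies below a point of
      \<open>W\<close> outside \<open>U\<close>, which is again in the upset \<open>A\<close>;
      likewise for \<open>B\<close>. Directedness bounds the two by some \<open>t\<close> outside
      \<open>U\<close>, yet \<open>t\<close> lies in \<open>A \<inter> B \<subseteq> P\<close> and
      in \<open>W\<close>.\<close>
    then obtain a b where a: "a \<in> A" "a \<in> W" "a \<notin> U" and b: "b \<in> B" "b \<in> W" "b \<notin> U"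
      using A B unfolding P_def W_def upset_def by blast
    have "a \<in> ?T" "b \<in> ?T" using a b w x by (auto simp: W_def intro: le_trans[of x w])
    then obtain t where t: "t \<in> carrier S" "t \<notin> U" "a \<sqsubseteq>\<^bsub>S\<^esub> t" "b \<sqsubseteq>\<^bsub>S\<^esub> t"
      using directed[rule_format, of a b] a b by (auto simp: W_def)
    have "t \<in> W" using t a W by (auto simp: upset_def)
    moreover have "t \<in> P" using t a b A B AB by (auto simp: upset_def)
    ultimately show False using t by (auto simp: P_def)
  qed
  ultimately have "prime_upset S P" using P xP x by (auto simp: prime_upset_def)
  with UP xP \<open>j P = P\<close> show ?thesis by blast
qed

text \<open>Distinct elements of a chain are comparable, so an antichain has at most one
  element.\<close>

lemma (in total_order) finite_if_antichain: "antichain L A \<Longrightarrow> finite A"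
proof -
  assume A: "antichain L A"
  have "A \<subseteq> {x}" if "x \<in> A" for x
    using A that total_order_total unfolding antichain_def by (metis singletonI subsetD subsetI)
  then show "finite A" by (metis finite.simps finite_subset subsetI)
qed

theorem corollary4p2:
  fixes S :: "('a, 'c) gorder_scheme"
  assumes "partial_order S"
  shows "((\<nexists>A. antichain S A \<and> infinite A) \<longrightarrow> spatial (nuclei_frame (upset_frame S)))
       \<and> (total_order S \<longrightarrow> spatial (nuclei_frame (upset_frame S)))"
proof -
  have *: "spatial (nuclei_frame (upset_frame S))" if "\<nexists>A. antichain S A \<and> infinite A"
    using partial_order.axioms(1)[OF assms] that
    by (intro spatial_nuclei_if_enough_fixed_primes enough_fixed_primes_if_no_infinite_antichain)
  then show ?thesis using total_order.finite_if_antichain by blast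
qed

end
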